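(* Let $\kappa$ be a cardinal and $U$ an ultrafilter over $\kappa$. The $U$-measurable subsets of ${}^{\omega}\kappa$ form a $\sigma$-algebra of subsets of ${}^{\omega}\kappa$.
   Context: ${}^{<\omega}\kappa$ is the set of finite sequences from $\kappa$; $\frown$ is concatenation, $\langle\rangle$ the empty sequence. A tree is a subset of ${}^{<\omega}\kappa$ closed under initial segments; $[T]$ is the set of infinite branches of $T$. For $X\subseteq{}^{\omega}\kappa$ and $\sigma\in{}^{<\omega}\kappa$, $X\lfloor\sigma=\{s:\sigma\frown s\in X\}$. A tree $T$ is $U$-branching iff $\langle\rangle\in T$ and for each $\sigma\in T$, $\{\alpha\in\kappa:\sigma\frown\langle\alpha\rangle\in T\}\in U$. $X$ is $U$-large (resp. $U$-small) iff there is a $U$-branching tree $T$ with $[T]\subseteq X$ (resp. $[T]\cap X=\emptyset$); $X$ is $U$-determined iff it is $U$-large or $U$-small; $X$ is $U$-measurable iff $X\lfloor\sigma$ is $U$-determined for every $\sigma\in{}^{<\omega}\kappa$. *)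

theory Defs
  imports "HOL-Analysis.Sigma_Algebra" "HOL-Library.Omega_Words_Fun" "HOL-Library.FuncSet"
begin

text \<open>
  The underlying set of the cardinal is an arbitrary carrier \<open>K\<close>; the set of finite sequences
  from \<open>K\<close> is \<^term>\<open>lists K\<close>. Principal ultrafilters are not excluded.
\<close>

definition ultrafilter_over :: "'a set \<Rightarrow> 'a set set \<Rightarrow> bool" where
  "ultrafilter_over K U \<longleftrightarrow>
     U \<subseteq> Pow K \<and> K \<in> U \<and> {} \<notin> U \<and>
     (\<forall>A\<in>U. \<forall>B\<in>U. A \<inter> B \<in> U) \<and>
     (\<forall>A\<in>U. \<forall>B. A \<subseteq> B \<and> B \<subseteq> K \<longrightarrow> B \<in> U) \<and>
     (\<forall>A. A \<subseteq> K \<longrightarrow> A \<in> U \<or> K - A \<in> U)"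

definition omega_seqs :: "'a set \<Rightarrow> 'a word set" where
  "omega_seqs K = (UNIV \<rightarrow> K)"

definition is_tree :: "'a set \<Rightarrow> 'a list set \<Rightarrow> bool" where
  "is_tree K T \<longleftrightarrow> T \<subseteq> lists K \<and> (\<forall>\<sigma> \<tau>. \<sigma> @ \<tau> \<in> T \<longrightarrow> \<sigma> \<in> T)"

definition branches :: "'a set \<Rightarrow> 'a list set \<Rightarrow> 'a word set" where
  "branches K T = {s \<in> omega_seqs K. \<forall>n. s [0 \<rightarrow> n] \<in> T}"

definition section_at :: "'a set \<Rightarrow> 'a word set \<Rightarrow> 'a list \<Rightarrow> 'a word set" where
  "section_at K X \<sigma> = {s \<in> omega_seqs K. \<sigma> \<frown> s \<in> X}"

definition U_branching :: "'a set \<Rightarrow> 'a set set \<Rightarrow> 'a list set \<Rightarrow> bool" where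
  "U_branching K U T \<longleftrightarrow>
     is_tree K T \<and> [] \<in> T \<and> (\<forall>\<sigma>\<in>T. {\<alpha> \<in> K. \<sigma> @ [\<alpha>] \<in> T} \<in> U)"

definition U_large :: "'a set \<Rightarrow> 'a set set \<Rightarrow> 'a word set \<Rightarrow> bool" where
  "U_large K U X \<longleftrightarrow> (\<exists>T. U_branching K U T \<and> branches K T \<subseteq> X)"

definition U_small :: "'a set \<Rightarrow> 'a set set \<Rightarrow> 'a word set \<Rightarrow> bool" where
  "U_small K U X \<longleftrightarrow> (\<exists>T. U_branching K U T \<and> branches K T \<inter> X = {})"

definition U_determined :: "'a set \<Rightarrow> 'a set set \<Rightarrow> 'a word set \<Rightarrow> bool" where
  "U_determined K U X \<longleftrightarrow> U_large K U X \<or> U_small K U X"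

definition U_measurable :: "'a set \<Rightarrow> 'a set set \<Rightarrow> 'a word set \<Rightarrow> bool" where
  "U_measurable K U X \<longleftrightarrow> (\<forall>\<sigma>\<in>lists K. U_determined K U (section_at K X \<sigma>))"

end

theory Submission
  imports Defs
begin

text \<open>
  Only countable unions need an argument. Let \<open>X\<close> be the union of measurable sets \<open>X\<^sub>n\<close> and suppose
  that \<open>X\<close> is not large. If \<open>U\<close>-many one-step sections of a set are large then so is the set,
  hence at every \<open>\<sigma>\<close> with non-large section of \<open>X\<close>, the section at \<open>\<sigma> @ [\<alpha>]\<close> is non-large for
  \<open>U\<close>-many \<open>\<alpha>\<close>. At each such \<open>\<sigma>\<close> all sections of the \<open>X\<^sub>n\<close> are non-large, thus small. The
  \<open>U\<close>-branching tree that avoids \<open>X\<close> consists of non-large positions and enters, at level \<open>n\<close>, a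
  tree avoiding \<open>X\<^sub>n\<close>. A position of length \<open>n\<close> obeys only \<open>n + 1\<close> such trees,
  so no countable completeness of \<open>U\<close> is needed.
\<close>

section \<open>Sections of sets of infinite sequences\<close>

lemma conc_in_omega_seqs:
  "\<sigma> \<in> lists K \<Longrightarrow> s \<in> omega_seqs K \<Longrightarrow> \<sigma> \<frown> s \<in> omega_seqs K"
  by (fastforce simp: omega_seqs_def conc_def Pi_iff in_lists_conv_set)

lemma section_at_append:
  "\<tau> \<in> lists K \<Longrightarrow> section_at K (section_at K X \<sigma>) \<tau> = section_at K X (\<sigma> @ \<tau>)"
  using conc_in_omega_seqs unfolding section_at_def by fastforce

lemma section_at_Nil: "X \<subseteq> omega_seqs K \<Longrightarrow> section_at K X [] = X"
  by (auto simp: section_at_def)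

lemma section_at_subset: "section_at K X \<sigma> \<subseteq> omega_seqs K"
  by (auto simp: section_at_def)

lemma section_at_UN: "section_at K (\<Union>i. X i) \<sigma> = (\<Union>i. section_at K (X i) \<sigma>)"
  by (auto simp: section_at_def)

lemma section_at_Compl:
  "\<sigma> \<in> lists K \<Longrightarrow> section_at K (omega_seqs K - X) \<sigma> = omega_seqs K - section_at K X \<sigma>"
  using conc_in_omega_seqs unfolding section_at_def by fastforce

lemma suffix_in_omega_seqs: "s \<in> omega_seqs K \<Longrightarrow> suffix n s \<in> omega_seqs K"
  by (auto simp: omega_seqs_def)

lemma branches_subset: "branches K T \<subseteq> omega_seqs K"
  by (auto simp: branches_def)

section \<open>Largeness, complements and the empty set\<close>

lemma U_large_mono: "U_large K U X \<Longrightarrow> X \<subseteq> Y \<Longrightarrow> U_large K U Y"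
  unfolding U_large_def by blast

text \<open>The same tree serves both sets: its branches lie in \<open>omega_seqs K\<close>, so
  lying inside one set means missing the other.\<close>

lemma U_determined_Compl:
  assumes "U_determined K U X"
  shows "U_determined K U (omega_seqs K - X)"
  using assms branches_subset
  unfolding U_determined_def U_small_def U_large_def by blast

lemma U_measurable_Compl:
  "U_measurable K U X \<Longrightarrow> U_measurable K U (omega_seqs K - X)"
  by (simp add: U_measurable_def section_at_Compl U_determined_Compl)

text \<open>Sections of sections are sections at concatenated positions. This lets the union
  argument be carried out at the root only.\<close>

lemma U_measurable_section_at:
  "U_measurable K U X \<Longrightarrow> \<sigma> \<in> lists K \<Longrightarrow> U_measurable K U (section_at K X \<sigma>)"
  by (simp add: U_measurable_def section_at_append)

lemma U_measurable_empty:
  assumes "K \<in> U"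
  shows "U_measurable K U {}"
proof -
  have "U_branching K U (lists K)"
    using assms by (auto simp: U_branching_def is_tree_def)
  then have "U_small K U {}"
    by (auto simp: U_small_def)
  then show ?thesis
    by (simp add: U_measurable_def U_determined_def section_at_def)
qed

section \<open>Gluing trees over one-step sections\<close>

lemma U_large_if_sections_large:
  assumes A: "A \<in> U" "A \<subseteq> K"
    and large: "\<And>\<alpha>. \<alpha> \<in> A \<Longrightarrow> U_large K U (section_at K X [\<alpha>])"
  shows "U_large K U X"
proof -
  obtain S where S: "\<And>\<alpha>. \<alpha> \<in> A \<Longrightarrow> U_branching K U (S \<alpha>)"
    "\<And>\<alpha>. \<alpha> \<in> A \<Longrightarrow> branches K (S \<alpha>) \<subseteq> section_at K X [\<alpha>]"
    using large unfolding U_large_def by metis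
  have S_lists: "S \<alpha> \<subseteq> lists K" if "\<alpha> \<in> A" for \<alpha>
    using S(1)[OF that] by (simp add: U_branching_def is_tree_def)
  \<comment> \<open>The root gets successor set \<open>A\<close>, and a copy of
    \<open>S \<alpha>\<close> is hung above each \<open>[\<alpha>]\<close>; all other successor sets
    are inherited from \<open>S \<alpha>\<close>.\<close>
  define T where "T = {[]} \<union> {\<alpha> # \<tau> | \<alpha> \<tau>. \<alpha> \<in> A \<and> \<tau> \<in> S \<alpha>}"
  have Cons_T: "\<alpha> # \<tau> \<in> T \<longleftrightarrow> \<alpha> \<in> A \<and> \<tau> \<in> S \<alpha>" for \<alpha> \<tau>
    by (simp add: T_def)
  have Nil_T: "[] \<in> T"
    by (simp add: T_def)
  have "is_tree K T"
    unfolding is_tree_def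
  proof (intro conjI allI impI)
    show "T \<subseteq> lists K"
    proof
      fix \<rho> assume "\<rho> \<in> T"
      then consider "\<rho> = []" | \<alpha> \<tau> where "\<rho> = \<alpha> # \<tau>" "\<alpha> \<in> A" "\<tau> \<in> S \<alpha>"
        unfolding T_def by blast
      then show "\<rho> \<in> lists K"
        using A(2) S_lists by cases auto
    qed
    show "\<sigma> \<in> T" if "\<sigma> @ \<tau> \<in> T" for \<sigma> \<tau>
    proof (cases \<sigma>)
      case Nil
      then show ?thesis using Nil_T by simp
    next
      case (Cons \<alpha> \<rho>)
      then show ?thesis
        using that S(1)[of \<alpha>] by (auto simp: Cons_T U_branching_def is_tree_def)
    qed
  qed
  moreover have "{\<alpha> \<in> K. \<sigma> @ [\<alpha>] \<in> T} \<in> U" if "\<sigma> \<in> T" for \<sigma>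
  proof (cases \<sigma>)
    case Nil
    have "{\<alpha> \<in> K. [\<alpha>] \<in> T} = A"
      using A(2) S(1) by (auto simp: Cons_T U_branching_def)
    then show ?thesis using A(1) Nil by simp
  next
    case (Cons \<alpha> \<rho>)
    then show ?thesis
      using that S(1)[of \<alpha>] by (auto simp: Cons_T U_branching_def)
  qed
  ultimately have "U_branching K U T"
    using Nil_T by (simp add: U_branching_def)
  moreover have "branches K T \<subseteq> X"
  proof
    fix s assume s: "s \<in> branches K T"
    \<comment> \<open>With the first letter peeled off, the prefixes of \<open>s\<close> become
      prefixes of its shift, which is therefore a branch of \<open>S (s 0)\<close>.\<close>
    have split: "s [0 \<rightarrow> Suc n] = s 0 # suffix 1 s [0 \<rightarrow> n]" for n
      unfolding subsequence_def map_upt_Suc by simp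
    have "s [0 \<rightarrow> Suc n] \<in> T" for n
      using s unfolding branches_def by blast
    then have "s 0 \<in> A" and "suffix 1 s [0 \<rightarrow> n] \<in> S (s 0)" for n
      unfolding split Cons_T by blast+
    moreover have "suffix 1 s \<in> omega_seqs K"
      using s by (intro suffix_in_omega_seqs) (simp add: branches_def)
    ultimately have "suffix 1 s \<in> section_at K X [s 0]"
      using S(2)[of "s 0"] unfolding branches_def by blast
    moreover have "[s 0] \<frown> suffix 1 s = s"
      by (rule ext) (simp add: conc_def)
    ultimately show "s \<in> X"
      by (simp add: section_at_def)
  qed
  ultimately show ?thesis
    unfolding U_large_def by blast
qed

section \<open>Ultrafilters and non-large positions\<close>

lemma ultrafilter_over_mono:
  "ultrafilter_over K U \<Longrightarrow> A \<in> U \<Longrightarrow> A \<subseteq> B \<Longrightarrow> B \<subseteq> K \<Longrightarrow> B \<in> U"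
  unfolding ultrafilter_over_def by blast

text \<open>Comprehension over \<open>K\<close> makes the empty intersection \<open>K\<close> rather
  than \<open>UNIV\<close>.\<close>

lemma ultrafilter_over_INT_finite:
  assumes "ultrafilter_over K U" "finite I" "\<And>i. i \<in> I \<Longrightarrow> A i \<in> U"
  shows "{x \<in> K. \<forall>i\<in>I. x \<in> A i} \<in> U"
  using assms(2,3)
proof (induction I rule: finite_induct)
  case empty
  then show ?case using assms(1) by (simp add: ultrafilter_over_def)
next
  case (insert j I)
  have "{x \<in> K. \<forall>i\<in>insert j I. x \<in> A i} = A j \<inter> {x \<in> K. \<forall>i\<in>I. x \<in> A i}"
    using insert.prems[of j] assms(1) by (auto simp: ultrafilter_over_def)
  moreover have "A j \<in> U" "{x \<in> K. \<forall>i\<in>I. x \<in> A i} \<in> U"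
    using insert by auto
  ultimately show ?case
    using assms(1) by (simp add: ultrafilter_over_def)
qed

text \<open>Otherwise maximality of \<open>U\<close> would put the set of \<alpha> with large
  section into \<open>U\<close>, and gluing would make the section at \<sigma> large.\<close>

lemma non_large_sections_in_ultrafilter:
  assumes U: "ultrafilter_over K U"
    and not_large: "\<not> U_large K U (section_at K X \<sigma>)"
  shows "{\<alpha> \<in> K. \<not> U_large K U (section_at K X (\<sigma> @ [\<alpha>]))} \<in> U"
proof -
  define A where "A = {\<alpha> \<in> K. U_large K U (section_at K X (\<sigma> @ [\<alpha>]))}"
  have "A \<subseteq> K"
    by (auto simp: A_def)
  have "A \<notin> U"
  proof
    assume "A \<in> U"
    then have "U_large K U (section_at K X \<sigma>)"
      using \<open>A \<subseteq> K\<close>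
    proof (rule U_large_if_sections_large)
      fix \<alpha> assume "\<alpha> \<in> A"
      then show "U_large K U (section_at K (section_at K X \<sigma>) [\<alpha>])"
        by (simp add: A_def section_at_append)
    qed
    with not_large show False ..
  qed
  then have "K - A \<in> U"
    using U \<open>A \<subseteq> K\<close> unfolding ultrafilter_over_def by metis
  moreover have "K - A = {\<alpha> \<in> K. \<not> U_large K U (section_at K X (\<sigma> @ [\<alpha>]))}"
    by (auto simp: A_def)
  ultimately show ?thesis
    by simp
qed

section \<open>Countable unions\<close>

lemma U_determined_UN:
  fixes X :: "nat \<Rightarrow> 'a word set"
  assumes U: "ultrafilter_over K U"
    and sub: "\<And>n. X n \<subseteq> omega_seqs K"
    and meas: "\<And>n. U_measurable K U (X n)"
  shows "U_determined K U (\<Union>n. X n)"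
proof (cases "U_large K U (\<Union>n. X n)")
  case True
  then show ?thesis by (simp add: U_determined_def)
next
  case False
  define N where "N = {\<sigma> \<in> lists K. \<not> U_large K U (section_at K (\<Union>n. X n) \<sigma>)}"
  have "U_small K U (section_at K (X n) \<sigma>)" if "\<sigma> \<in> N" for \<sigma> n
  proof -
    have "section_at K (X n) \<sigma> \<subseteq> section_at K (\<Union>n. X n) \<sigma>"
      unfolding section_at_UN by blast
    then have "\<not> U_large K U (section_at K (X n) \<sigma>)"
      using that U_large_mono unfolding N_def by blast
    then show ?thesis
      using that meas[of n] unfolding N_def U_measurable_def U_determined_def by blast
  qed
  \<comment> \<open>The index is tied to the length, so each position handles a single set and a
    branch meets every \<open>X n\<close> at its prefix of length \<open>n\<close>.\<close>
  then have "\<forall>\<sigma>\<in>N. \<exists>T. U_branching K U T \<and>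
      branches K T \<inter> section_at K (X (length \<sigma>)) \<sigma> = {}"
    unfolding U_small_def by blast
  then obtain S where S: "\<And>\<sigma>. \<sigma> \<in> N \<Longrightarrow> U_branching K U (S \<sigma>)"
    "\<And>\<sigma>. \<sigma> \<in> N \<Longrightarrow> branches K (S \<sigma>) \<inter> section_at K (X (length \<sigma>)) \<sigma> = {}"
    by metis
  \<comment> \<open>Past each prefix, \<sigma> must stay in the tree chosen there. The case
    \<open>i = length \<sigma>\<close> puts \<sigma> itself into \<open>N\<close>.\<close>
  define T where "T = {\<sigma>. \<forall>i\<le>length \<sigma>. take i \<sigma> \<in> N \<and> drop i \<sigma> \<in> S (take i \<sigma>)}"
  have T_D: "take i \<sigma> \<in> N" "drop i \<sigma> \<in> S (take i \<sigma>)" if "\<sigma> \<in> T" "i \<le> length \<sigma>" for \<sigma> i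
    using that unfolding T_def by blast+
  have T_N: "\<sigma> \<in> N" if "\<sigma> \<in> T" for \<sigma>
    using T_D(1)[OF that, of "length \<sigma>"] by simp
  have Nil_N: "[] \<in> N"
    using False sub by (simp add: N_def section_at_Nil UN_least)
  have Nil_S: "[] \<in> S \<sigma>" if "\<sigma> \<in> N" for \<sigma>
    using S(1)[OF that] by (simp add: U_branching_def)
  have "is_tree K T"
    unfolding is_tree_def
  proof (intro conjI allI impI)
    show "T \<subseteq> lists K"
      using T_N by (auto simp: N_def)
    show "\<sigma> \<in> T" if "\<sigma> @ \<tau> \<in> T" for \<sigma> \<tau>
      unfolding T_def
    proof (intro CollectI allI impI)
      fix i assume i: "i \<le> length \<sigma>"
      then have "i \<le> length (\<sigma> @ \<tau>)"
        by simp
      then have "take i \<sigma> \<in> N" "drop i \<sigma> @ \<tau> \<in> S (take i \<sigma>)"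
        using T_D[OF that, of i] i by simp_all
      then show "take i \<sigma> \<in> N \<and> drop i \<sigma> \<in> S (take i \<sigma>)"
        using S(1)[of "take i \<sigma>"] unfolding U_branching_def is_tree_def by blast
    qed
  qed
  moreover have "[] \<in> T"
    using Nil_N Nil_S by (simp add: T_def)
  moreover have "{\<alpha> \<in> K. \<sigma> @ [\<alpha>] \<in> T} \<in> U" if \<sigma>: "\<sigma> \<in> T" for \<sigma>
  proof -
    \<comment> \<open>\<open>?B\<close> keeps the extension in \<open>N\<close>; \<open>?C\<close>
      keeps it in the finitely many trees already entered.\<close>
    let ?B = "{\<alpha> \<in> K. \<not> U_large K U (section_at K (\<Union>n. X n) (\<sigma> @ [\<alpha>]))}"
    define A where "A i = {\<alpha> \<in> K. drop i \<sigma> @ [\<alpha>] \<in> S (take i \<sigma>)}" for i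
    let ?C = "{\<alpha> \<in> K. \<forall>i\<in>{..length \<sigma>}. \<alpha> \<in> A i}"
    have "?B \<in> U"
      using non_large_sections_in_ultrafilter[OF U] T_N[OF \<sigma>] by (simp add: N_def)
    moreover have "?C \<in> U"
    proof (rule ultrafilter_over_INT_finite[OF U])
      fix i assume "i \<in> {..length \<sigma>}"
      then have "take i \<sigma> \<in> N" "drop i \<sigma> \<in> S (take i \<sigma>)"
        using T_D[OF \<sigma>] by simp_all
      then show "A i \<in> U"
        using S(1) unfolding U_branching_def A_def by blast
    qed simp
    ultimately have "?B \<inter> ?C \<in> U"
      using U by (simp add: ultrafilter_over_def)
    moreover have "?B \<inter> ?C \<subseteq> {\<alpha> \<in> K. \<sigma> @ [\<alpha>] \<in> T}"
    proof
      fix \<alpha> assume \<alpha>: "\<alpha> \<in> ?B \<inter> ?C"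
      have N: "\<sigma> @ [\<alpha>] \<in> N"
        using \<alpha> T_N[OF \<sigma>] by (simp add: N_def)
      have "take i (\<sigma> @ [\<alpha>]) \<in> N \<and> drop i (\<sigma> @ [\<alpha>]) \<in> S (take i (\<sigma> @ [\<alpha>]))"
        if i: "i \<le> length (\<sigma> @ [\<alpha>])" for i
      proof (cases "i \<le> length \<sigma>")
        case True
        then have "take i \<sigma> \<in> N"
          using T_D(1)[OF \<sigma>] by simp
        with True \<alpha> show ?thesis
          by (auto simp: A_def)
      next
        case False
        \<comment> \<open>The only new prefix is the whole sequence, whose own tree need contain
          only \<open>[]\<close>.\<close>
        with i have "i = length (\<sigma> @ [\<alpha>])"
          by simp
        with N Nil_S[OF N] show ?thesis
          by simp
      qed
      with \<alpha> show "\<alpha> \<in> {\<alpha> \<in> K. \<sigma> @ [\<alpha>] \<in> T}"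
        unfolding T_def by blast
    qed
    ultimately show ?thesis
      by (rule ultrafilter_over_mono[OF U]) auto
  qed
  ultimately have "U_branching K U T"
    by (simp add: U_branching_def)
  moreover have "s \<notin> X n" if s: "s \<in> branches K T" for s n
  proof -
    let ?\<sigma> = "s [0 \<rightarrow> n]"
    have T: "s [0 \<rightarrow> k] \<in> T" for k
      using s by (simp add: branches_def)
    \<comment> \<open>The constraint at prefix length \<open>n\<close>, read off from all longer
      prefixes of \<open>s\<close>, makes the tail a branch of \<open>S ?\<sigma>\<close>.\<close>
    have "suffix n s [0 \<rightarrow> k] \<in> S ?\<sigma>" for k
    proof -
      have "take n (s [0 \<rightarrow> n + k]) = ?\<sigma>" "drop n (s [0 \<rightarrow> n + k]) = suffix n s [0 \<rightarrow> k]"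
        by (auto intro!: nth_equalityI simp: subsequence_def)
      then show ?thesis
        using T_D(2)[OF T[of "n + k"], of n] by simp
    qed
    moreover have "suffix n s \<in> omega_seqs K"
      using s by (intro suffix_in_omega_seqs) (simp add: branches_def)
    ultimately have "suffix n s \<in> branches K (S ?\<sigma>)"
      by (simp add: branches_def)
    then have "suffix n s \<notin> section_at K (X (length ?\<sigma>)) ?\<sigma>"
      using S(2)[OF T_N[OF T]] by blast
    with \<open>suffix n s \<in> omega_seqs K\<close> show "s \<notin> X n"
      by (simp add: section_at_def)
  qed
  ultimately have "U_small K U (\<Union>n. X n)"
    unfolding U_small_def by blast
  then show ?thesis
    by (simp add: U_determined_def)
qed

text \<open>Taking sections commutes with unions, so the root case applies to the sections at each
  position.\<close>

lemma U_measurable_UN: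
  fixes X :: "nat \<Rightarrow> 'a word set"
  assumes "ultrafilter_over K U" "\<And>n. U_measurable K U (X n)"
  shows "U_measurable K U (\<Union>n. X n)"
  unfolding U_measurable_def section_at_UN
  by (intro ballI U_determined_UN assms section_at_subset U_measurable_section_at)

theorem theorem5p6:
  fixes \<kappa> :: "'a rel" and U :: "'a set set"
  assumes "Card_order \<kappa>"
    and "ultrafilter_over (Field \<kappa>) U"
  shows "sigma_algebra (omega_seqs (Field \<kappa>))
           {X. X \<subseteq> omega_seqs (Field \<kappa>) \<and> U_measurable (Field \<kappa>) U X}"
proof -
  have "Field \<kappa> \<in> U"
    using assms(2) by (simp add: ultrafilter_over_def)
  then show ?thesis
    unfolding sigma_algebra_iff2
    using assms(2)
    by (auto simp: U_measurable_empty U_measurable_Compl image_subset_iff intro!: U_measurable_UN)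
qed

end
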